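(* Let $n\geq 3$ be an integer and let $e$ be a natural number with $e<\binom{n}{2}-\frac{n}{2}$. Then a minimizer graph in $\mathcal{G}_{n,e}$ has no vertex of degree $n-1$.
   Context: All graphs are finite, simple and undirected. $\mathcal{G}_{n,e}$ is the set of all connected simple graphs on $n$ vertices with $e$ edges; $\rho(G)$ is the largest eigenvalue of the adjacency matrix of $G$; a minimizer of $\mathcal{G}_{n,e}$ is a graph $G\in\mathcal{G}_{n,e}$ whose spectral radius equals $\min\{\rho(H):H\in\mathcal{G}_{n,e}\}$. *)

theory Defs
  imports
    Complex_Main
    "Graph_Theory.Graph_Theory"
    "Jordan_Normal_Form.Spectral_Radius"
begin

(* A finite simple undirected graph is a pair_graph: a finite, loop-free, symmetric
   set of ordered pairs. Each undirected edge {u, v} is present as the two arcs (u, v) and (v, u);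
   the degree of v is out_degree G v, the number of its neighbours. *)

definition edge_set :: "'a pair_pre_digraph \<Rightarrow> 'a set set" where
  "edge_set G = {{u, v} | u v. (u, v) \<in> parcs G}"

(* Labelled graphs on the fixed vertex set {0..<n}. All notions below are invariant under
   isomorphism, and every graph on n vertices is isomorphic to one of these. *)
definition connected_graphs :: "nat \<Rightarrow> nat \<Rightarrow> nat pair_pre_digraph set" where
  "connected_graphs n e =
     {G. pair_graph G \<and> pverts G = {0..<n} \<and> card (edge_set G) = e \<and>
         Digraph_Component.connected (with_proj G)}"

definition adjacency_matrix :: "nat pair_pre_digraph \<Rightarrow> real mat" where
  "adjacency_matrix G =
     mat (card (pverts G)) (card (pverts G)) (\<lambda>(i, j). if (i, j) \<in> parcs G then 1 else 0)"

(* The adjacency matrix is real symmetric, so its spectrum over the reals contains all its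
   eigenvalues; it is finite and, for n > 0, nonempty. *)
definition rho :: "nat pair_pre_digraph \<Rightarrow> real" where
  "rho G = Max (spectrum (adjacency_matrix G))"

(* connected_graphs n e is finite, so Min is a genuine minimum whenever G exists. *)
definition minimizer :: "nat \<Rightarrow> nat \<Rightarrow> nat pair_pre_digraph \<Rightarrow> bool" where
  "minimizer n e G \<longleftrightarrow>
     G \<in> connected_graphs n e \<and> rho G = Min (rho ` connected_graphs n e)"

end

theory Submission
  imports Defs "HOL-Analysis.Function_Topology"
begin

text \<open>
  If every degree were at least $n - 2$, then $2e \geq n(n-2)$; hence some vertex $w$ of a minimizer
  $G$ has two non-neighbours $u \neq u'$. Suppose $v$ has degree $n - 1$ and let
  $G' = G - uv + uw$, which is again connected. Let $x > 0$ and $y \geq 0$ be Perron vectors of $G$ and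
  $G'$, with eigenvalues $\rho$ and $\rho'$. Evaluating $x^T (A - A') y$ in two ways gives
  $(\rho - \rho')\, x \cdot y = x_u (y_v - y_w) + y_u (x_v - x_w)$. The eigenvalue equations at $v$ and $w$
  give $(\rho + 1)(x_v - x_w) \geq x_u + x_{u'}$ and $(\rho' + 1)(y_v - y_w) \geq y_{u'} - y_u$.
  If $\rho \leq \rho'$, then $0 \geq x_u y_{u'} + y_u x_{u'}$, which forces $y_u = 0$ and hence $y = 0$.
\<close>

section \<open>Perron vectors of symmetric nonnegative matrices\<close>

text \<open>Vectors are total functions of which only the entries below \<open>n\<close> count, so
  that compactness can come from the product topology on functions.\<close>

definition bilin :: "nat \<Rightarrow> (nat \<Rightarrow> nat \<Rightarrow> real) \<Rightarrow> (nat \<Rightarrow> real) \<Rightarrow> (nat \<Rightarrow> real) \<Rightarrow> real" where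
  "bilin n A x y = (\<Sum>i<n. x i * (\<Sum>j<n. A i j * y j))"

lemma bilin_commute:
  assumes "\<And>i j. A i j = A j i"
  shows "bilin n A x y = bilin n A y x"
proof -
  have "bilin n A x y = (\<Sum>i<n. \<Sum>j<n. x i * A i j * y j)"
    by (simp add: bilin_def sum_distrib_left mult.assoc)
  also have "\<dots> = (\<Sum>j<n. \<Sum>i<n. x i * A i j * y j)"
    by (rule sum.swap)
  also have "\<dots> = (\<Sum>j<n. \<Sum>i<n. y j * A j i * x i)"
    using assms by (intro sum.cong refl) (simp add: mult_ac)
  also have "\<dots> = bilin n A y x"
    by (simp add: bilin_def sum_distrib_left mult.assoc)
  finally show ?thesis .
qed

lemma bilin_add_scaled:
  assumes "\<And>i j. A i j = A j i"
  shows "bilin n A (\<lambda>i. x i + t * z i) (\<lambda>i. x i + t * z i)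
       = bilin n A x x + 2 * t * bilin n A z x + t\<^sup>2 * bilin n A z z"
proof -
  have "bilin n A (\<lambda>i. x i + t * z i) (\<lambda>i. x i + t * z i)
      = bilin n A x x + t * bilin n A x z + t * bilin n A z x + t\<^sup>2 * bilin n A z z"
    unfolding bilin_def
    by (simp add: algebra_simps sum.distrib sum_distrib_left power2_eq_square)
  then show ?thesis
    using bilin_commute[OF assms, where n = n and x = x and y = z] by simp
qed

text \<open>Close to 0 the linear term outweighs the quadratic one, so a nonzero \<open>g\<close>
  would give a positive value at a small \<open>t\<close> of the same sign. The choice
  \<open>d = \<bar>c\<bar> + 1\<close> makes \<open>t = g / d\<close> small enough.\<close>

lemma linear_coeff_zero_of_quadratic_nonpos:
  fixes g c :: real
  assumes "\<And>t. 2 * t * g + t\<^sup>2 * c \<le> 0"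
  shows "g = 0"
proof (rule ccontr)
  assume g: "g \<noteq> 0"
  define d where "d = \<bar>c\<bar> + 1"
  have d: "d > 0" "2 * d + c > 0"
    by (auto simp: d_def)
  have "2 * (g / d) * g + (g / d)\<^sup>2 * c = g\<^sup>2 * (2 * d + c) / d\<^sup>2"
    using d(1) by (simp add: field_simps power2_eq_square)
  also have "\<dots> > 0"
    using g d by simp
  finally show False
    using assms[of "g / d"] by simp
qed

text \<open>Pinning the coordinates from \<open>n\<close> on to 0 places the sphere inside a product
  of compact sets, which is compact by Tychonoff, and the norm condition is closed.\<close>

lemma compact_sphere_nat_fun:
  "compact {x :: nat \<Rightarrow> real. (\<forall>i\<ge>n. x i = 0) \<and> (\<Sum>i<n. (x i)\<^sup>2) = 1}" (is "compact ?S")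
proof -
  define K where "K = PiE UNIV (\<lambda>i. if i < n then {-1..1::real} else {0})"
  have "compactin (product_topology (\<lambda>i::nat. euclidean) UNIV) K"
    unfolding K_def by (subst compactin_PiE) auto
  then have K: "compact K"
    by (simp add: euclidean_product_topology)
  have C: "closed {x :: nat \<Rightarrow> real. (\<Sum>i<n. (x i)\<^sup>2) = 1}"
    by (intro closed_Collect_eq continuous_intros continuous_on_product_coordinates)
  have "x i \<in> {-1..1}" if "(\<Sum>i<n. (x i)\<^sup>2) = 1" "i < n" for x :: "nat \<Rightarrow> real" and i
  proof -
    have "(x i)\<^sup>2 \<le> (\<Sum>i<n. (x i)\<^sup>2)"
      using that(2) by (intro member_le_sum) auto
    then have "\<bar>x i\<bar> \<le> 1"
      using that(1) by (simp add: abs_square_le_1)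
    then show ?thesis
      by auto
  qed
  then have "?S = K \<inter> {x. (\<Sum>i<n. (x i)\<^sup>2) = 1}"
    by (auto simp: K_def PiE_UNIV_domain Pi_iff split: if_splits)
  then show ?thesis
    using compact_Int_closed[OF K C] by simp
qed

text \<open>Positivity may fail for a reducible matrix, so only nonnegativity is asked; positivity
  is derived later from a dominating vertex.\<close>

definition perron_vec :: "nat \<Rightarrow> (nat \<Rightarrow> nat \<Rightarrow> real) \<Rightarrow> real \<Rightarrow> (nat \<Rightarrow> real) \<Rightarrow> bool" where
  "perron_vec n A r x \<longleftrightarrow>
     (\<forall>i<n. 0 \<le> x i) \<and> (\<exists>i<n. x i \<noteq> 0) \<and> (\<forall>i<n. (\<Sum>j<n. A i j * x j) = r * x i)"

text \<open>A maximizer of the quadratic form on the unit sphere can be made nonnegative by taking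
  absolute values, and a maximizer is an eigenvector because the first variation vanishes. The bound
  in the second conclusion later identifies \<open>r\<close> as the largest eigenvalue.\<close>

lemma perron_vec_exists:
  fixes A :: "nat \<Rightarrow> nat \<Rightarrow> real"
  assumes n: "n > 0" and sym: "\<And>i j. A i j = A j i" and nonneg: "\<And>i j. 0 \<le> A i j"
  obtains r x where "perron_vec n A r x"
    and "\<And>z. bilin n A z z \<le> r * (\<Sum>i<n. (z i)\<^sup>2)"
proof -
  define S where "S = {x :: nat \<Rightarrow> real. (\<forall>i\<ge>n. x i = 0) \<and> (\<Sum>i<n. (x i)\<^sup>2) = 1}"
  have "(\<Sum>i<n. (of_bool (i = 0) :: real)\<^sup>2) = 1"
    using n by (simp add: power2_eq_square flip: of_bool_conj)
  then have "(\<lambda>i. of_bool (i = 0)) \<in> S"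
    using n by (auto simp: S_def)
  then have "S \<noteq> {}"
    by blast
  moreover have "continuous_on S (\<lambda>x. bilin n A x x)"
    unfolding bilin_def
    by (intro continuous_intros continuous_on_subset[OF continuous_on_product_coordinates]) auto
  ultimately obtain x0 where x0: "x0 \<in> S" "\<And>z. z \<in> S \<Longrightarrow> bilin n A z z \<le> bilin n A x0 x0"
    using continuous_attains_sup[of S "\<lambda>x. bilin n A x x"] compact_sphere_nat_fun[of n]
    unfolding S_def by blast
  define r where "r = bilin n A x0 x0"
  define x where "x = (\<lambda>i. \<bar>x0 i\<bar>)"
  have max: "bilin n A z z \<le> r * (\<Sum>i<n. (z i)\<^sup>2)" for z
  proof (cases "(\<Sum>i<n. (z i)\<^sup>2) = 0")
    case True
    then have "\<forall>i<n. z i = 0"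
      by (subst (asm) sum_nonneg_eq_0_iff) auto
    then show ?thesis
      by (simp add: bilin_def)
  next
    case False
    define N where "N = (\<Sum>i<n. (z i)\<^sup>2)"
    have N: "N > 0"
      using False by (simp add: N_def sum_nonneg order_less_le)
    \<comment> \<open>Besides being normalized, \<open>z\<close> is cut off from \<open>n\<close>
      on, since members of \<open>S\<close> vanish there.\<close>
    define z' where "z' = (\<lambda>i. if i < n then z i / sqrt N else 0)"
    have "(\<Sum>i<n. (z' i)\<^sup>2) = (\<Sum>i<n. (z i)\<^sup>2 / N)"
      using N by (intro sum.cong) (auto simp: z'_def power_divide)
    also have "\<dots> = 1"
      using N by (simp add: sum_divide_distrib[symmetric] N_def)
    finally have "z' \<in> S"
      by (simp add: S_def z'_def)
    then have "bilin n A z' z' \<le> r"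
      using x0(2) r_def by simp
    moreover have "bilin n A z' z' = bilin n A z z / N"
    proof -
      have "bilin n A z' z' = (\<Sum>i<n. z i / sqrt N * (\<Sum>j<n. A i j * (z j / sqrt N)))"
        by (simp add: bilin_def z'_def)
      also have "\<dots> = (\<Sum>i<n. (z i * (\<Sum>j<n. A i j * z j)) / N)"
        using N by (simp add: sum_divide_distrib[symmetric])
      finally show ?thesis
        by (simp add: bilin_def sum_divide_distrib)
    qed
    ultimately show ?thesis
      using N by (simp add: N_def field_simps)
  qed
  have Nx: "(\<Sum>i<n. (x i)\<^sup>2) = 1"
    using x0(1) by (simp add: S_def x_def)
  \<comment> \<open>As the entries of \<open>A\<close> are nonnegative, absolute values can only
    raise each term; hence \<open>x\<close> is a maximizer as well.\<close>
  have "bilin n A x0 x0 \<le> bilin n A x x"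
    unfolding bilin_def sum_distrib_left x_def
  proof (intro sum_mono)
    fix i j
    have "x0 i * (A i j * x0 j) \<le> \<bar>x0 i * (A i j * x0 j)\<bar>"
      by simp
    also have "\<dots> = \<bar>x0 i\<bar> * (A i j * \<bar>x0 j\<bar>)"
      using nonneg by (simp add: abs_mult)
    finally show "x0 i * (A i j * x0 j) \<le> \<bar>x0 i\<bar> * (A i j * \<bar>x0 j\<bar>)" .
  qed
  then have qx: "bilin n A x x = r"
    using max[of x] Nx r_def by simp
  have eig: "(\<Sum>j<n. A i j * x j) = r * x i" if i: "i < n" for i
  proof -
    \<comment> \<open>Perturbing along the \<open>i\<close>-th unit vector turns \<open>max\<close>
      into a quadratic inequality in \<open>t\<close> whose linear coefficient is the defect of the
      eigenvalue equation at \<open>i\<close>.\<close>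
    define u :: "nat \<Rightarrow> real" where "u = (\<lambda>j. of_bool (j = i))"
    have u1: "(\<Sum>j<n. u j * f j) = f i" for f
      using i by (simp add: u_def)
    have "2 * t * ((\<Sum>j<n. A i j * x j) - r * x i) + t\<^sup>2 * (bilin n A u u - r) \<le> 0" for t
    proof -
      have "(\<Sum>j<n. (x j + t * u j)\<^sup>2)
          = (\<Sum>j<n. (x j)\<^sup>2) + 2 * t * (\<Sum>j<n. u j * x j) + t\<^sup>2 * (\<Sum>j<n. u j * u j)"
        by (simp add: power2_eq_square algebra_simps sum.distrib sum_distrib_left)
      also have "\<dots> = 1 + 2 * t * x i + t\<^sup>2"
        by (simp add: u1 Nx) (simp add: u_def)
      finally have "bilin n A x x + 2 * t * bilin n A u x + t\<^sup>2 * bilin n A u u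
          \<le> r * (1 + 2 * t * x i + t\<^sup>2)"
        using max[of "\<lambda>j. x j + t * u j"] bilin_add_scaled[OF sym, where n = n and x = x and t = t and z = u]
        by simp
      moreover have "bilin n A u x = (\<Sum>j<n. A i j * x j)"
        by (simp add: bilin_def u1)
      ultimately show ?thesis
        by (simp add: qx algebra_simps)
    qed
    then have "(\<Sum>j<n. A i j * x j) - r * x i = 0"
      by (rule linear_coeff_zero_of_quadratic_nonpos)
    then show ?thesis
      by simp
  qed
  have "\<exists>i<n. x i \<noteq> 0"
  proof (rule ccontr)
    assume "\<not> ?thesis"
    then have "(\<Sum>i<n. (x i)\<^sup>2) = 0"
      by simp
    then show False
      using Nx by simp
  qed
  then have "perron_vec n A r x"
    using eig by (simp add: perron_vec_def x_def)
  then show ?thesis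
    using max that by blast
qed

text \<open>The bound on the quadratic form, applied to any real eigenvector, puts its eigenvalue
  below \<open>r\<close>, and \<open>r\<close> itself is attained.\<close>

lemma Max_spectrum_perron_vec:
  fixes A :: "nat \<Rightarrow> nat \<Rightarrow> real"
  assumes n: "n > 0" and sym: "\<And>i j. A i j = A j i" and nonneg: "\<And>i j. 0 \<le> A i j"
  obtains x where "perron_vec n A (Max (spectrum (mat n n (\<lambda>(i, j). A i j)))) x"
proof -
  obtain r x where x: "perron_vec n A r x"
    and max: "\<And>z. bilin n A z z \<le> r * (\<Sum>i<n. (z i)\<^sup>2)"
    using perron_vec_exists[of n A] assms by metis
  define M where "M = mat n n (\<lambda>(i, j). A i j)"
  have M: "M \<in> carrier_mat n n"
    by (simp add: M_def)
  have mult: "(M *\<^sub>v z) $ i = (\<Sum>j<n. A i j * z $ j)" if "z \<in> carrier_vec n" "i < n" for z i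
    using that by (auto simp: M_def scalar_prod_def atLeast0LessThan intro!: sum.cong)
  have "Max (spectrum M) = r"
  proof (rule Max_eqI)
    show "finite (spectrum M)"
      using card_finite_spectrum[OF M] by simp
  next
    fix k
    assume "k \<in> spectrum M"
    then obtain z where z: "z \<in> carrier_vec n" "z \<noteq> 0\<^sub>v n" "M *\<^sub>v z = k \<cdot>\<^sub>v z"
      using M by (auto simp: spectrum_def eigenvalue_def eigenvector_def)
    have "(\<Sum>j<n. A i j * z $ j) = k * z $ i" if "i < n" for i
      using mult[OF z(1) that] z that by simp
    then have "bilin n A (\<lambda>i. z $ i) (\<lambda>i. z $ i) = k * (\<Sum>i<n. (z $ i)\<^sup>2)"
      by (simp add: bilin_def sum_distrib_left power2_eq_square mult_ac)
    then have le: "k * (\<Sum>i<n. (z $ i)\<^sup>2) \<le> r * (\<Sum>i<n. (z $ i)\<^sup>2)"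
      using max[of "\<lambda>i. z $ i"] by simp
    obtain i where "i < n" "z $ i \<noteq> 0"
      using z(1,2) by (auto simp: vec_eq_iff)
    then have "(\<Sum>i<n. (z $ i)\<^sup>2) > 0"
      by (intro sum_pos2[of _ i]) auto
    then show "k \<le> r"
      using le by simp
  next
    have "M *\<^sub>v vec n x = r \<cdot>\<^sub>v vec n x"
    proof (intro eq_vecI)
      fix i
      assume "i < dim_vec (r \<cdot>\<^sub>v vec n x)"
      then have i: "i < n"
        by simp
      then show "(M *\<^sub>v vec n x) $ i = (r \<cdot>\<^sub>v vec n x) $ i"
        using mult[of "vec n x" i] x by (simp add: perron_vec_def)
    qed (simp add: M_def)
    moreover have "vec n x \<noteq> 0\<^sub>v n"
      using x by (auto simp: perron_vec_def vec_eq_iff)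
    ultimately show "r \<in> spectrum M"
      using M by (auto simp: spectrum_def eigenvalue_def eigenvector_def intro!: exI[of _ "vec n x"])
  qed
  then show ?thesis
    using that x by (simp add: M_def)
qed

section \<open>Graphs on an initial segment\<close>

definition adj :: "(nat \<times> nat) set \<Rightarrow> nat \<Rightarrow> nat \<Rightarrow> real" where
  "adj E i j = of_bool ((i, j) \<in> E)"

lemma rho_perron_vec:
  assumes "n > 0" and "pverts G = {0..<n}" and "sym (parcs G)"
  obtains x where "perron_vec n (adj (parcs G)) (rho G) x"
proof -
  have "adjacency_matrix G = mat n n (\<lambda>(i, j). adj (parcs G) i j)"
    using assms(2) by (simp add: adjacency_matrix_def adj_def of_bool_def)
  moreover have "adj (parcs G) i j = adj (parcs G) j i" for i j
    using assms(3) by (auto simp: adj_def dest: symD)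
  moreover have "0 \<le> adj (parcs G) i j" for i j
    by (simp add: adj_def)
  ultimately show ?thesis
    using Max_spectrum_perron_vec[of n "adj (parcs G)" thesis] assms(1) that by (simp add: rho_def)
qed

text \<open>Trades the locale for conditions on the arc set, which are easily checked after a
  rotation.\<close>

lemma pair_graph_segment_iff:
  fixes G :: "nat pair_pre_digraph"
  shows "pair_graph G \<and> pverts G = {0..<n} \<longleftrightarrow>
   pverts G = {0..<n} \<and> parcs G \<subseteq> {0..<n} \<times> {0..<n} \<and> sym (parcs G) \<and> irrefl (parcs G)"
    (is "?L \<longleftrightarrow> ?R")
proof
  assume L: ?L
  then interpret pair_graph G
    by simp
  show ?R
    using L arc_fst_in_verts arc_snd_in_verts pair_no_loops pair_sym_arcs
    by (fastforce simp: irrefl_def symmetric_def)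
next
  assume R: ?R
  then have "finite (parcs G)"
    using finite_subset[of "parcs G" "{0..<n} \<times> {0..<n}"] by simp
  then have "pair_graph G"
    using R by unfold_locales (auto simp: irrefl_def symmetric_def)
  then show ?L
    using R by simp
qed

lemma finite_connected_graphs: "finite (connected_graphs n e)"
proof (rule finite_subset)
  show "connected_graphs n e \<subseteq>
      (\<lambda>E. \<lparr>pverts = {0..<n}, parcs = E\<rparr>) ` Pow ({0..<n} \<times> {0..<n})"
  proof
    fix G
    assume "G \<in> connected_graphs n e"
    then have "pverts G = {0..<n}" "parcs G \<subseteq> {0..<n} \<times> {0..<n}"
      using pair_graph_segment_iff[of G n] by (auto simp: connected_graphs_def)
    then show "G \<in> (\<lambda>E. \<lparr>pverts = {0..<n}, parcs = E\<rparr>) ` Pow ({0..<n} \<times> {0..<n})"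
      by (intro image_eqI[of _ _ "parcs G"]) auto
  qed
qed simp

section \<open>Degree counting: a vertex with two nonneighbours\<close>

lemma card_parcs_le:
  assumes "finite (parcs G)"
  shows "card (parcs G) \<le> 2 * card (edge_set G)"
proof -
  \<comment> \<open>The arcs are sorted by their underlying edge; each fibre holds at most the two
    orientations.\<close>
  define P where "P = (\<lambda>s. {p \<in> parcs G. {fst p, snd p} = s})"
  have eq: "edge_set G = (\<lambda>p. {fst p, snd p}) ` parcs G"
    by (force simp: edge_set_def)
  then have fin: "finite (edge_set G)"
    using assms by simp
  have "parcs G = (\<Union>s\<in>edge_set G. P s)"
    by (auto simp: eq P_def)
  then have "card (parcs G) \<le> (\<Sum>s\<in>edge_set G. card (P s))"
    using card_UN_le[OF fin, of P] by simp
  also have "\<dots> \<le> (\<Sum>s\<in>edge_set G. 2)"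
  proof (rule sum_mono)
    fix s
    assume "s \<in> edge_set G"
    then obtain a b where s: "s = {a, b}"
      by (auto simp: edge_set_def)
    have "P s \<subseteq> {(a, b), (b, a)}"
      by (auto simp: P_def s doubleton_eq_iff)
    then have "card (P s) \<le> card {(a, b), (b, a)}"
      by (intro card_mono) auto
    also have "\<dots> \<le> 2"
      using card_length[of "[(a, b), (b, a)]"] by simp
    finally show "card (P s) \<le> 2" .
  qed
  finally show ?thesis
    by simp
qed

lemma exists_two_nonneighbours:
  assumes E: "parcs G \<subseteq> {0..<n} \<times> {0..<n}"
    and e: "real (card (edge_set G)) < real (n choose 2) - real n / 2"
  obtains w u u' where "w < n" "u < n" "u' < n" "u \<noteq> w" "u' \<noteq> w" "u \<noteq> u'"
    "(w, u) \<notin> parcs G" "(w, u') \<notin> parcs G"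
proof -
  \<comment> \<open>For \<open>n < 2\<close> the bound in \<open>e\<close> is at most 0. From 2 on,
    the natural number \<open>n - 2\<close> is a true difference.\<close>
  have n: "n \<ge> 2"
    using e by (cases "n < 2") (auto simp: binomial_eq_0)
  have fin: "finite (parcs G)"
    using finite_subset[OF E] by simp
  have "\<exists>w<n. card {j \<in> {0..<n}. (w, j) \<in> parcs G} < n - 2"
  proof (rule ccontr)
    assume "\<not> ?thesis"
    then have ge: "n - 2 \<le> card {j \<in> {0..<n}. (w, j) \<in> parcs G}" if "w < n" for w
      using that not_less by blast
    have "parcs G = (SIGMA w:{0..<n}. {j \<in> {0..<n}. (w, j) \<in> parcs G})"
      using E by auto
    then have "card (parcs G) = (\<Sum>w\<in>{0..<n}. card {j \<in> {0..<n}. (w, j) \<in> parcs G})"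
      by (subst \<open>parcs G = _\<close>, subst card_SigmaI) auto
    also have "\<dots> \<ge> (\<Sum>w\<in>{0..<n}. n - 2)"
      using ge by (intro sum_mono) auto
    finally have "n * (n - 2) \<le> 2 * card (edge_set G)"
      using card_parcs_le[OF fin] by simp
    then have "real (n * (n - 2)) \<le> real (2 * card (edge_set G))"
      by (simp only: of_nat_le_iff)
    \<comment> \<open>With this value the bound in \<open>e\<close> is n(n-2)/2, exactly half of the
      degree sum just obtained.\<close>
    moreover have "real (n choose 2) = real n * (real n - 1) / 2"
      using n by (simp add: choose_two real_of_nat_div of_nat_diff)
    ultimately show False
      using e n by (simp add: of_nat_diff algebra_simps)
  qed
  then obtain w where w: "w < n" "card {j \<in> {0..<n}. (w, j) \<in> parcs G} < n - 2"
    by blast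
  \<comment> \<open>Leaving out \<open>w\<close> itself costs one vertex: at most n-3 neighbours and
    \<open>w\<close> leave at least two vertices for \<open>D\<close>.\<close>
  define D where "D = {j \<in> {0..<n}. j \<noteq> w \<and> (w, j) \<notin> parcs G}"
  have "{0..<n} = {j \<in> {0..<n}. (w, j) \<in> parcs G} \<union> {w} \<union> D"
    using w by (auto simp: D_def)
  then have "n = card ({j \<in> {0..<n}. (w, j) \<in> parcs G} \<union> {w} \<union> D)"
    by (metis card_atLeastLessThan diff_zero)
  also have "\<dots> \<le> card {j \<in> {0..<n}. (w, j) \<in> parcs G} + card {w} + card D"
    by (intro order_trans[OF card_Un_le] add_right_mono card_Un_le)
  finally have "n \<le> card {j \<in> {0..<n}. (w, j) \<in> parcs G} + 1 + card D"
    by simp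
  then have "2 \<le> card D"
    using w by linarith
  then obtain T where "T \<subseteq> D" "card T = 2"
    using obtain_subset_with_card_n by metis
  then obtain u u' where "u \<in> D" "u' \<in> D" "u \<noteq> u'"
    by (auto simp: card_2_iff)
  then show ?thesis
    using that[of w u u'] w by (auto simp: D_def)
qed

section \<open>Rotating an edge away from a dominating vertex\<close>

definition rotate_arcs :: "nat \<Rightarrow> nat \<Rightarrow> nat \<Rightarrow> (nat \<times> nat) set \<Rightarrow> (nat \<times> nat) set" where
  "rotate_arcs u v w E = (E - {(u, v), (v, u)}) \<union> {(u, w), (w, u)}"

text \<open>Positivity is established for \<open>x\<close> alone. For \<open>y\<close>, a zero at
  \<open>u\<close> is propagated along the arcs of the rotated graph until nothing is left.\<close>

lemma rotate_spectral_decrease: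
  assumes n: "u < n" "v < n" "w < n" "u' < n"
    and ne: "u \<noteq> w" "u' \<noteq> w" "u \<noteq> u'"
    and E: "sym E" "irrefl E"
    and dom: "\<And>j. j < n \<Longrightarrow> j \<noteq> v \<Longrightarrow> (v, j) \<in> E"
    and non: "(w, u) \<notin> E" "(w, u') \<notin> E"
    and x: "perron_vec n (adj E) r x"
    and y: "perron_vec n (adj (rotate_arcs u v w E)) r' y"
  shows "r' < r"
proof (rule ccontr)
  assume "\<not> r' < r"
  then have rr: "r \<le> r'"
    by simp
  define F where "F = rotate_arcs u v w E"
  \<comment> \<open>The vertex \<open>v\<close> has no nonneighbour, whereas \<open>w\<close> has
    two; and \<open>u\<close>, \<open>u'\<close> are not adjacent to \<open>w\<close>, while
    \<open>v\<close> is.\<close>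
  have wv: "w \<noteq> v" "u \<noteq> v" "u' \<noteq> v"
    using dom non n ne E by (blast dest: symD)+
  have symE: "(i, j) \<in> E \<longleftrightarrow> (j, i) \<in> E" for i j
    using E by (blast dest: symD)
  have irr: "(i, i) \<notin> E" for i
    using E by (auto simp: irrefl_def)
  have domE: "(v, j) \<in> E \<longleftrightarrow> j \<noteq> v" if "j < n" for j
    using dom that irr by auto
  have x0: "0 \<le> x i" and ex: "(\<Sum>j<n. adj E i j * x j) = r * x i" if "i < n" for i
    using x that by (auto simp: perron_vec_def)
  have y0: "0 \<le> y i" and ey: "(\<Sum>j<n. adj F i j * y j) = r' * y i" if "i < n" for i
    using y that by (auto simp: perron_vec_def F_def)

  have neighbour_le: "z j \<le> (\<Sum>j<n. adj H i j * z j)"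
    if "(i, j) \<in> H" "j < n" "\<And>k. k < n \<Longrightarrow> 0 \<le> z k" for H z i j
  proof -
    have "adj H i j * z j \<le> (\<Sum>j<n. adj H i j * z j)"
      using that by (intro member_le_sum) (auto simp: adj_def)
    then show ?thesis
      using that by (simp add: adj_def)
  qed
  have sum_of_bool: "(\<Sum>j<n. of_bool (j = i) * z j) = z i" if "i < n" for i and z :: "nat \<Rightarrow> real"
    using that by simp

  \<comment> \<open>If \<open>x v\<close> were 0, the equation at \<open>v\<close> would be a
    vanishing sum of nonnegative terms that involves every other vertex.\<close>
  have xv: "0 < x v"
  proof (rule ccontr)
    assume "\<not> 0 < x v"
    then have "x v = 0"
      using x0[OF n(2)] by simp
    then have "x j = 0" if "j < n" for j
      using neighbour_le[of v j E x] ex[OF n(2)] dom[of j] x0 that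
      by (cases "j = v") (auto intro: antisym)
    then show False
      using x by (auto simp: perron_vec_def)
  qed
  have xpos: "0 < x i" if "i < n" for i
  proof (cases "i = v")
    case False
    then have "x v \<le> r * x i"
      using neighbour_le[of i v E x] ex[OF that] x0 n domE symE that by auto
    then have "x i \<noteq> 0"
      using xv by auto
    then show ?thesis
      using x0[OF that] by simp
  qed (use xv in simp)
  have "0 \<le> (\<Sum>j<n. adj E v j * x j)"
    using x0 by (intro sum_nonneg mult_nonneg_nonneg) (auto simp: adj_def)
  then have "0 \<le> r * x v"
    using ex[OF n(2)] by simp
  then have r0: "0 \<le> r"
    using xv by (simp add: zero_le_mult_iff)

  \<comment> \<open>With the identity added, row \<open>v\<close> of \<open>E\<close> consists of
    ones, so it dominates row \<open>w\<close> entry by entry, with a gap of 1 at the nonneighbours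
    \<open>u\<close> and \<open>u'\<close>.\<close>
  have shift: "(\<Sum>j<n. (adj H i j + of_bool (j = i)) * z j) = (s + 1) * z i"
    if "(\<Sum>j<n. adj H i j * z j) = s * z i" "i < n" for H i s and z :: "nat \<Rightarrow> real"
    using that by (simp add: distrib_right sum.distrib)
  have "x u + x u' = (\<Sum>j<n. (of_bool (j = u) + of_bool (j = u')) * x j)"
    using n by (simp add: distrib_right sum.distrib)
  also have "\<dots> \<le> (\<Sum>j<n. ((adj E v j + of_bool (j = v)) - (adj E w j + of_bool (j = w))) * x j)"
    using ne non wv x0 by (intro sum_mono mult_right_mono) (auto simp: adj_def domE irr)
  also have "\<dots> = (r + 1) * (x v - x w)"
    using shift[OF ex] n by (simp add: left_diff_distrib sum_subtractf right_diff_distrib)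
  finally have dx: "x u + x u' \<le> (r + 1) * (x v - x w)" .

  \<comment> \<open>After the rotation \<open>u\<close> is adjacent to \<open>w\<close> but not to
    \<open>v\<close>, so the row difference is -1 at \<open>u\<close>; it is still 1 at
    \<open>u'\<close> and nonnegative elsewhere.\<close>
  have "y u' - y u = (\<Sum>j<n. (of_bool (j = u') - of_bool (j = u)) * y j)"
    using n by (simp add: left_diff_distrib sum_subtractf)
  also have "\<dots> \<le> (\<Sum>j<n. ((adj F v j + of_bool (j = v)) - (adj F w j + of_bool (j = w))) * y j)"
    using ne non wv y0
    by (intro sum_mono mult_right_mono) (auto simp: adj_def domE irr F_def rotate_arcs_def)
  also have "\<dots> = (r' + 1) * (y v - y w)"
    using shift[OF ey] n by (simp add: left_diff_distrib sum_subtractf right_diff_distrib)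
  finally have dy: "y u' - y u \<le> (r' + 1) * (y v - y w)" .

  \<comment> \<open>The correction is exact because \<open>u\<close> is adjacent to \<open>v\<close>
    and not to \<open>w\<close> in \<open>E\<close>.\<close>
  have adjF: "adj F i j = adj E i j
      - of_bool (i = u) * of_bool (j = v) - of_bool (i = v) * of_bool (j = u)
      + of_bool (i = u) * of_bool (j = w) + of_bool (i = w) * of_bool (j = u)" for i j
  proof (cases "(i, j) \<in> {(u, v), (v, u), (u, w), (w, u)}")
    case True
    have "(v, u) \<in> E" "(u, v) \<in> E" "(w, u) \<notin> E" "(u, w) \<notin> E"
      using domE[OF n(1)] non wv symE by auto
    then show ?thesis
      using True ne wv by (elim insertE emptyE) (simp_all add: adj_def F_def rotate_arcs_def)
  next
    case False
    then have "(i, j) \<in> F \<longleftrightarrow> (i, j) \<in> E"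
      by (auto simp: F_def rotate_arcs_def)
    then show ?thesis
      using False by (auto simp: adj_def)
  qed
  have rowF: "(\<Sum>j<n. adj F i j * y j) = (\<Sum>j<n. adj E i j * y j)
      - of_bool (i = u) * y v - of_bool (i = v) * y u
      + of_bool (i = u) * y w + of_bool (i = w) * y u" for i
    using n unfolding adjF
    by (simp add: distrib_right left_diff_distrib sum.distrib sum_subtractf mult.assoc
        sum_distrib_left[symmetric])
  define s where "s = (\<Sum>i<n. x i * y i)"
  have "bilin n (adj F) x y = bilin n (adj E) x y - x u * y v - x v * y u + x u * y w + x w * y u"
  proof -
    have pick: "(\<Sum>i<n. x i * (of_bool (i = k) * c)) = x k * c" if "k < n" for k c
      using sum_of_bool[OF that, of "\<lambda>i. x i * c"] by (simp only: mult_ac)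
    show ?thesis
      unfolding bilin_def rowF using n
      by (simp add: distrib_left right_diff_distrib sum.distrib sum_subtractf pick del: sum_mult_of_bool_eq)
  qed
  moreover have "bilin n (adj F) x y = r' * s"
    unfolding bilin_def s_def sum_distrib_left[of r'] using ey
    by (intro sum.cong) (auto simp: mult_ac)
  \<comment> \<open>The eigenvector for \<open>E\<close> is \<open>x\<close>, in the left slot, so
    the form is transposed first.\<close>
  moreover have "bilin n (adj E) x y = r * s"
  proof -
    have "bilin n (adj E) x y = bilin n (adj E) y x"
      using symE by (intro bilin_commute) (simp add: adj_def)
    also have "\<dots> = r * s"
      unfolding bilin_def s_def sum_distrib_left[of r] using ex
      by (intro sum.cong) (auto simp: mult_ac)
    finally show ?thesis .
  qed
  ultimately have key: "x u * (y v - y w) + y u * (x v - x w) = (r - r') * s"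
    by (simp add: algebra_simps)
  have "0 \<le> s"
    using x0 y0 by (auto simp: s_def intro!: sum_nonneg)
  then have "(r - r') * s \<le> 0"
    using rr by (simp add: mult_nonpos_nonneg)
  then have "(r' + 1) * (x u * (y v - y w) + y u * (x v - x w)) \<le> 0"
    using key rr r0 by (simp add: mult_nonneg_nonpos)
  moreover have "x u * (y u' - y u) \<le> x u * ((r' + 1) * (y v - y w))"
    using dy x0 n by (intro mult_left_mono) auto
  moreover have "y u * (x u + x u') \<le> y u * ((r' + 1) * (x v - x w))"
  proof (rule mult_left_mono)
    \<comment> \<open>Enlarging the factor \<open>r + 1\<close> of \<open>dx\<close> to
      \<open>r' + 1\<close> takes a nonnegative difference \<open>x v - x w\<close>, which
      \<open>dx\<close> itself supplies.\<close>
    have "0 < (r + 1) * (x v - x w)"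
      using dx xpos[OF n(1)] xpos[OF n(4)] by linarith
    then have "0 \<le> x v - x w"
      using r0 by (simp add: zero_less_mult_iff)
    then have "(r + 1) * (x v - x w) \<le> (r' + 1) * (x v - x w)"
      using rr by (intro mult_right_mono) auto
    then show "x u + x u' \<le> (r' + 1) * (x v - x w)"
      using dx by linarith
  qed (use y0 n in auto)
  \<comment> \<open>The unwanted term \<open>- x u * y u\<close> from \<open>dy\<close> cancels
    against \<open>y u * x u\<close> from \<open>dx\<close>.\<close>
  ultimately have "x u * y u' + y u * x u' \<le> 0"
    by (simp add: algebra_simps)
  moreover have "0 \<le> x u * y u'" "0 \<le> y u * x u'"
    using x0 y0 n by simp_all
  ultimately have "y u * x u' = 0"
    by linarith
  then have yu: "y u = 0"
    using xpos[OF n(4)] by simp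
  \<comment> \<open>Zeros of \<open>y\<close> pass to neighbours in \<open>F\<close>: from
    \<open>u\<close> over the new edge to \<open>w\<close>, on to \<open>v\<close>, and from there
    to everything except \<open>u\<close>.\<close>
  have spread: "y j = 0" if "y i = 0" "(i, j) \<in> F" "i < n" "j < n" for i j
    using neighbour_le[of i j F y] ey[of i] y0 that by (auto intro: antisym)
  have "y w = 0"
    using spread[OF yu, of w] n by (simp add: F_def rotate_arcs_def)
  then have "y v = 0"
    using spread[of w v] n wv ne symE[of w v] domE[of w] by (simp add: F_def rotate_arcs_def)
  then have "y j = 0" if "j < n" for j
    using spread[of v j] n wv ne domE[of j] yu that
    by (cases "j = u \<or> j = v") (auto simp: F_def rotate_arcs_def)
  then show False
    using y by (auto simp: perron_vec_def)
qed

section \<open>The rotation stays inside the class of connected graphs\<close>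

lemma connected_if_reachable_from:
  assumes G: "pair_graph G" and v: "v \<in> pverts G"
    and reach: "\<And>j. j \<in> pverts G \<Longrightarrow> (v, j) \<in> (parcs G)\<^sup>*"
  shows "Digraph_Component.connected (with_proj G)"
proof -
  interpret pair_graph G
    by (rule G)
  have sym: "sym (parcs G)"
    using pair_sym_arcs by (simp add: symmetric_def)
  have on: "(i, j) \<in> rtrancl_on (pverts G) (parcs G)"
    if "(i, j) \<in> (parcs G)\<^sup>*" "i \<in> pverts G" for i j
    using that
  proof (induction rule: rtrancl_induct)
    case (step j k)
    then show ?case
      using arc_snd_in_verts[of "(j, k)"] by (auto intro: rtrancl_on_into_rtrancl_on)
  qed auto
  \<comment> \<open>By symmetry the path from \<open>v\<close> to \<open>i\<close> can be reversed
    and continued to \<open>j\<close>.\<close>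
  have "(i, j) \<in> (parcs G)\<^sup>*" if "i \<in> pverts G" "j \<in> pverts G" for i j
    using reach[OF that(1)] reach[OF that(2)] sym_rtrancl[OF sym]
    by (meson rtrancl_trans symD)
  then show ?thesis
    using on v by (intro connectedI reachable_mk_symmetricI) (auto simp: reachable_def)
qed

text \<open>The deleted arcs are the whole preimage of the edge between \<open>u\<close> and
  \<open>v\<close>, so forgetting orientations commutes with the deletion.\<close>

lemma edge_set_rotate_arcs:
  "edge_set (G\<lparr>parcs := rotate_arcs u v w (parcs G)\<rparr>) =
    insert {u, w} (edge_set G - {{u, v}})"
proof -
  define f :: "nat \<times> nat \<Rightarrow> nat set" where "f = (\<lambda>p. {fst p, snd p})"
  have eq: "edge_set H = f ` parcs H" for H
    by (force simp: edge_set_def f_def)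
  have "f p = {u, v} \<longleftrightarrow> p \<in> {(u, v), (v, u)}" for p
    by (cases p) (auto simp: f_def doubleton_eq_iff)
  then have "{(u, v), (v, u)} = f -` {{u, v}}"
    by (simp add: set_eq_iff)
  moreover have "f ` (A - f -` B) = f ` A - B" for A B
    by auto
  moreover have "f ` {(u, w), (w, u)} = {{u, w}}"
    by (auto simp: f_def)
  ultimately show ?thesis
    by (simp add: eq rotate_arcs_def image_Un)
qed

text \<open>All vertices but \<open>u\<close> remain neighbours of \<open>v\<close>, and
  \<open>u\<close> is reached through \<open>w\<close>. The edge count is kept because a present
  edge is exchanged for an absent one.\<close>

lemma rotate_in_connected_graphs:
  assumes G: "G \<in> connected_graphs n e"
    and n: "u < n" "v < n" "w < n" and ne: "u \<noteq> w"
    and dom: "\<And>j. j < n \<Longrightarrow> j \<noteq> v \<Longrightarrow> (v, j) \<in> parcs G"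
    and non: "(w, u) \<notin> parcs G"
  shows "G\<lparr>parcs := rotate_arcs u v w (parcs G)\<rparr> \<in> connected_graphs n e" (is "?H \<in> _")
proof -
  have seg: "pverts G = {0..<n}" "parcs G \<subseteq> {0..<n} \<times> {0..<n}" "sym (parcs G)" "irrefl (parcs G)"
    and e: "card (edge_set G) = e"
    using G pair_graph_segment_iff[of G n] by (auto simp: connected_graphs_def)
  have wv: "w \<noteq> v" "u \<noteq> v"
    using dom non n ne seg(3) by (blast dest: symD)+
  have uv: "(u, v) \<in> parcs G"
    using dom[of u] n wv seg(3) by (blast dest: symD)
  have "pverts ?H = {0..<n} \<and> parcs ?H \<subseteq> {0..<n} \<times> {0..<n} \<and> sym (parcs ?H) \<and> irrefl (parcs ?H)"
    using seg n ne by (auto simp: rotate_arcs_def sym_def irrefl_def)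
  then have H: "pair_graph ?H" "pverts ?H = {0..<n}"
    using pair_graph_segment_iff[of ?H n] by auto
  have vj: "(v, j) \<in> parcs ?H" if "j < n" "j \<noteq> v" "j \<noteq> u" for j
    using dom[OF that(1,2)] that wv by (auto simp: rotate_arcs_def)
  have "(v, j) \<in> (parcs ?H)\<^sup>*" if "j < n" for j
  proof (cases "j = u")
    case True
    have "(v, w) \<in> parcs ?H" "(w, u) \<in> parcs ?H"
      using vj[of w] n wv ne by (auto simp: rotate_arcs_def)
    then show ?thesis
      using True by (meson converse_rtrancl_into_rtrancl r_into_rtrancl)
  qed (use vj that in \<open>cases "j = v"; auto\<close>)
  then have conn: "Digraph_Component.connected (with_proj ?H)"
    using H n by (intro connected_if_reachable_from[of _ v]) auto
  have "finite (edge_set G)"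
    using seg(2) by (auto intro!: finite_subset[of _ "Pow {0..<n}"] simp: edge_set_def)
  moreover have "{u, v} \<in> edge_set G"
    using uv by (auto simp: edge_set_def)
  moreover have "{u, w} \<notin> edge_set G"
    using non seg(3) by (auto simp: edge_set_def doubleton_eq_iff dest: symD)
  ultimately have "card (insert {u, w} (edge_set G - {{u, v}})) = card (edge_set G)"
    by (metis Diff_iff card_Suc_Diff1 card_insert_disjoint finite_Diff)
  then have "card (edge_set ?H) = e"
    using e by (simp add: edge_set_rotate_arcs)
  then show ?thesis
    using H conn by (simp add: connected_graphs_def)
qed

text \<open>Without loops the out-neighbours of \<open>v\<close> lie among the n-1 other vertices,
  so they exhaust them.\<close>

lemma adjacent_if_out_degree_eq:
  assumes "parcs G \<subseteq> {0..<n} \<times> {0..<n}" and "irrefl (parcs G)" and "v < n"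
    and deg: "out_degree (with_proj G) v = n - 1" and "j < n" and "j \<noteq> v"
  shows "(v, j) \<in> parcs G"
proof -
  define N where "N = {k. (v, k) \<in> parcs G}"
  have "out_arcs (with_proj G) v = Pair v ` N"
    by (auto simp: out_arcs_def N_def)
  then have "card N = n - 1"
    using deg by (simp add: out_degree_def card_image inj_on_def)
  moreover have "N \<subseteq> {0..<n} - {v}"
    using assms(1,2) by (auto simp: N_def irrefl_def)
  ultimately have "N = {0..<n} - {v}"
    using \<open>v < n\<close> by (intro card_subset_eq) auto
  then have "j \<in> N"
    using assms(5,6) by simp
  then show ?thesis
    by (simp add: N_def)
qed

theorem theorem3p7:
  fixes n e :: nat and G :: "nat pair_pre_digraph"
  assumes "n \<ge> 3"
    and "real e < real (n choose 2) - real n / 2"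
    and "minimizer n e G"
  shows "\<not> (\<exists>v \<in> pverts G. out_degree (with_proj G) v = n - 1)"
proof
  assume "\<exists>v \<in> pverts G. out_degree (with_proj G) v = n - 1"
  moreover have G: "G \<in> connected_graphs n e" and min: "rho G = Min (rho ` connected_graphs n e)"
    using assms(3) by (auto simp: minimizer_def)
  moreover from G have seg: "pverts G = {0..<n}" "parcs G \<subseteq> {0..<n} \<times> {0..<n}"
      "sym (parcs G)" "irrefl (parcs G)" and e: "card (edge_set G) = e"
    using pair_graph_segment_iff[of G n] by (auto simp: connected_graphs_def)
  ultimately obtain v where v: "v < n" and deg: "out_degree (with_proj G) v = n - 1"
    by auto
  have dom: "(v, j) \<in> parcs G" if "j < n" "j \<noteq> v" for j
    using adjacent_if_out_degree_eq[OF seg(2,4) v deg that] .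
  obtain w u u' where w: "w < n" "u < n" "u' < n" "u \<noteq> w" "u' \<noteq> w" "u \<noteq> u'"
    "(w, u) \<notin> parcs G" "(w, u') \<notin> parcs G"
    using exists_two_nonneighbours[OF seg(2)] assms(2) e by metis
  \<comment> \<open>\<open>H\<close> competes with \<open>G\<close> in the same class, so a strict
    drop of \<open>rho\<close> contradicts minimality.\<close>
  define H where "H = G\<lparr>parcs := rotate_arcs u v w (parcs G)\<rparr>"
  have H: "H \<in> connected_graphs n e"
    unfolding H_def using G w v dom by (intro rotate_in_connected_graphs) auto
  then have segH: "pverts H = {0..<n}" "sym (parcs H)"
    using pair_graph_segment_iff[of H n] by (auto simp: connected_graphs_def)
  obtain x where x: "perron_vec n (adj (parcs G)) (rho G) x"
    using rho_perron_vec[of n G] v seg by auto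
  obtain y where "perron_vec n (adj (parcs H)) (rho H) y"
    using rho_perron_vec[of n H] v segH by auto
  then have y: "perron_vec n (adj (rotate_arcs u v w (parcs G))) (rho H) y"
    by (simp add: H_def)
  have "rho H < rho G"
    using rotate_spectral_decrease[OF w(2) v w(1,3-6) seg(3,4) dom w(7,8) x y] .
  moreover have "rho G \<le> rho H"
    unfolding min using finite_connected_graphs H by (intro Min_le) auto
  ultimately show False
    by simp
qed

end
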